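(* Let $0<p<1$ be a constant and let $m\ge 1$, $n\ge 1$ be integers. For $N\ge 1$ let $G(N,p)$ be the random graph on vertex set $\{0,1,\dots,N-1\}$ in which each pair of distinct vertices is joined by an edge independently with probability $p$. Then the probability that the robber has a winning strategy in the cops and robber game with traps, with $m$ cops equipped to place $n$ traps and one robber, played on $G(N,p)$, tends to $1$ as $N\to\infty$.
   Context: Cops and robber game on a finite simple graph $G$: graphs are treated as reflexive, i.e. a player may stay at its current vertex as a move. The cops and one robber occupy vertices of $G$; the game is played with perfect information in a countable sequence of rounds, cops and robber moving alternately; in the cops' turn all cops move simultaneously, each along an edge to an adjacent vertex or staying put, and in the robber's turn the robber moves along an edge to an adjacent vertex or stays put. Game with traps: additionally the cops have $n$ traps; a cop may set a trap on a vertex when it arrives there, and a trap can be removed (and reused elsewhere) when a cop arrives again at that vertex, so at most $n$ traps are on the graph at any time. The robber is caught, and the cops win, if after some finite number of rounds the robber occupies the same vertex as some cop or some vertex carrying a trap; the robber wins if he is never caught in an infinite play. *)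

theory Defs
  imports "HOL-Probability.Probability" "Graph_Theory.Pair_Digraph"
begin

subsection \<open>The game of cops and robber with traps\<close>

text \<open>A finite simple graph is a \<^typ>\<open>'a pair_pre_digraph\<close> satisfying \<^locale>\<open>pair_graph\<close>
  (an undirected edge is a pair of opposite arcs). It has no loops; the reflexivity of the
  game is the disjunct \<open>u = v\<close> below.\<close>

definition step :: "'a pair_pre_digraph \<Rightarrow> 'a \<Rightarrow> 'a \<Rightarrow> bool" where
  "step G u v \<longleftrightarrow> v \<in> pverts G \<and> (u = v \<or> (u, v) \<in> parcs G)"

text \<open>Positions of the individual cops, and the set of vertices carrying a trap.\<close>

type_synonym 'a cops = "'a list \<times> 'a set"

text \<open>\<open>m\<close> cops choose their starting vertices. Being placed on a vertex counts as arriving there.\<close>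

definition cops_start :: "nat \<Rightarrow> nat \<Rightarrow> 'a pair_pre_digraph \<Rightarrow> 'a cops \<Rightarrow> bool" where
  "cops_start m n G = (\<lambda>(C, T).
     length C = m \<and> set C \<subseteq> pverts G \<and> T \<subseteq> set C \<and> card T \<le> n)"

text \<open>All cops move simultaneously; the traps may change (be set or be removed) only at the
  vertices at which some cop arrives. Staying put is a move along the loop of the reflexive
  graph, so it counts as arriving. The \<open>n\<close> traps form a common pool.\<close>

definition cops_move :: "nat \<Rightarrow> 'a pair_pre_digraph \<Rightarrow> 'a cops \<Rightarrow> 'a cops \<Rightarrow> bool" where
  "cops_move n G = (\<lambda>(C, T) (C', T').
     list_all2 (step G) C C' \<and> T' - T \<subseteq> set C' \<and> T - T' \<subseteq> set C' \<and> card T' \<le> n)"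

definition cops_play :: "nat \<Rightarrow> nat \<Rightarrow> 'a pair_pre_digraph \<Rightarrow> (nat \<Rightarrow> 'a cops) \<Rightarrow> bool" where
  "cops_play m n G c \<longleftrightarrow> cops_start m n G (c 0) \<and> (\<forall>k. cops_move n G (c k) (c (Suc k)))"

definition robber_play :: "'a pair_pre_digraph \<Rightarrow> (nat \<Rightarrow> 'a) \<Rightarrow> bool" where
  "robber_play G r \<longleftrightarrow> r 0 \<in> pverts G \<and> (\<forall>k. step G (r k) (r (Suc k)))"

definition captures :: "'a cops \<Rightarrow> 'a \<Rightarrow> bool" where
  "captures = (\<lambda>(C, T) v. v \<in> set C \<or> v \<in> T)"

text \<open>The play runs \<open>c 0, r 0, c 1, r 1, \<dots>\<close>, where round 0 consists of the initial placements.
  The robber can be caught by his own move (\<open>r k\<close> against \<open>c k\<close>) or by the cops' next move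
  (\<open>r k\<close> against \<open>c (Suc k)\<close>).\<close>

definition caught :: "(nat \<Rightarrow> 'a cops) \<Rightarrow> (nat \<Rightarrow> 'a) \<Rightarrow> bool" where
  "caught c r \<longleftrightarrow> (\<exists>k. captures (c k) (r k) \<or> captures (c (Suc k)) (r k))"

text \<open>A strategy of the robber determines his next vertex from the history of the play: the
  configurations \<open>[c 0, \<dots>, c k]\<close> of the cops and his own positions \<open>[r 0, \<dots>, r (k - 1)]\<close>.\<close>

type_synonym 'a robber_strategy = "'a cops list \<Rightarrow> 'a list \<Rightarrow> 'a"

definition follows :: "'a robber_strategy \<Rightarrow> (nat \<Rightarrow> 'a cops) \<Rightarrow> (nat \<Rightarrow> 'a) \<Rightarrow> bool" where
  "follows \<sigma> c r \<longleftrightarrow> (\<forall>k. r k = \<sigma> (map c [0..<Suc k]) (map r [0..<k]))"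

definition winning_robber_strategy ::
    "nat \<Rightarrow> nat \<Rightarrow> 'a pair_pre_digraph \<Rightarrow> 'a robber_strategy \<Rightarrow> bool" where
  "winning_robber_strategy m n G \<sigma> \<longleftrightarrow>
     (\<forall>c r. cops_play m n G c \<and> follows \<sigma> c r \<longrightarrow> robber_play G r \<and> \<not> caught c r)"

definition robber_wins :: "nat \<Rightarrow> nat \<Rightarrow> 'a pair_pre_digraph \<Rightarrow> bool" where
  "robber_wins m n G \<longleftrightarrow> (\<exists>\<sigma>. winning_robber_strategy m n G \<sigma>)"


subsection \<open>The binomial random graph\<close>

definition vertex_pairs :: "nat \<Rightarrow> nat set set" where
  "vertex_pairs N = {e. e \<subseteq> {..<N} \<and> card e = 2}"

definition graph_of :: "nat \<Rightarrow> (nat set \<Rightarrow> bool) \<Rightarrow> nat pair_pre_digraph" where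
  "graph_of N \<omega> = \<lparr>pverts = {..<N}, parcs = {(u, v). {u, v} \<in> vertex_pairs N \<and> \<omega> {u, v}}\<rparr>"

definition random_graph :: "nat \<Rightarrow> real \<Rightarrow> nat pair_pre_digraph pmf" where
  "random_graph N p =
     map_pmf (graph_of N) (Pi_pmf (vertex_pairs N) False (\<lambda>_. bernoulli_pmf p))"

lemma pair_graph_graph_of: "pair_graph (graph_of N \<omega>)"
proof
  have "parcs (graph_of N \<omega>) \<subseteq> {..<N} \<times> {..<N}"
    by (auto simp: graph_of_def vertex_pairs_def)
  then show "finite (parcs (graph_of N \<omega>))"
    by (rule finite_subset) simp
  show "symmetric (with_proj (graph_of N \<omega>))"
    by (auto simp: symmetric_def sym_def graph_of_def insert_commute)
qed (auto simp: graph_of_def vertex_pairs_def)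

lemma pair_graph_random_graph: "G \<in> set_pmf (random_graph N p) \<Longrightarrow> pair_graph G"
  by (auto simp: random_graph_def pair_graph_graph_of)

end

theory Submission
  imports Defs "HOL-Real_Asymp.Real_Asymp"
begin

text \<open>With \<open>k = m + n\<close>, asymptotically almost surely every vertex \<open>u\<close> has, for every set \<open>B\<close> of at
  most \<open>k\<close> further vertices, a neighbour outside \<open>B\<close> that is adjacent to no vertex of \<open>B\<close>: for given
  \<open>u\<close> and \<open>B\<close>, each of the remaining \<open>N - k - 1\<close> vertices independently qualifies with probability
  \<open>p (1 - p)\<^sup>k\<close>, and there are at most \<open>N\<^sup>k\<^sup>+\<^sup>1\<close> choices of \<open>u\<close> and \<open>B\<close>. In such a graph the robber,
  standing at \<open>u\<close>, lets \<open>B\<close> consist of the cops and the traps and moves to such a neighbour. No cop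
  can reach it in one move, so neither a cop nor a new trap gets him before his next move.\<close>

section \<open>The robber's strategy on an evasive graph\<close>

definition evasive :: "nat \<Rightarrow> 'a pair_pre_digraph \<Rightarrow> bool" where
  "evasive k G \<longleftrightarrow> (\<forall>B u. B \<subseteq> pverts G \<and> card B \<le> k \<and> u \<in> pverts G - B \<longrightarrow>
     (\<exists>z \<in> pverts G - B. (u, z) \<in> parcs G \<and> (\<forall>b\<in>B. (b, z) \<notin> parcs G)))"

text \<open>Traps and cops count differently: a trap only has to be elsewhere, whereas a cop must be
  unable to reach \<open>v\<close> in one move. Reflexivity of \<open>step\<close> also covers a cop
  standing on \<open>v\<close>.\<close>

definition safe :: "'a pair_pre_digraph \<Rightarrow> 'a cops \<Rightarrow> 'a \<Rightarrow> bool" where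
  "safe G = (\<lambda>(C, T) v. v \<in> pverts G \<and> v \<notin> T \<and> (\<forall>x\<in>set C. \<not> step G x v))"

lemma safe_not_captures: "safe G c v \<Longrightarrow> \<not> captures c v"
  by (auto simp: safe_def captures_def step_def)

text \<open>A trap that appears in this move lies under a cop of \<open>C'\<close>, so keeping
  \<open>C'\<close> away from \<open>v\<close> rules out new traps as well.\<close>

lemma safe_not_captures_move:
  assumes "safe G c v" "cops_move n G c c'"
  shows "\<not> captures c' v"
proof -
  obtain C T C' T' where c: "c = (C, T)" "c' = (C', T')" by (cases c, cases c')
  then have mv: "list_all2 (step G) C C'" "T' - T \<subseteq> set C'"
    using assms(2) by (auto simp: cops_move_def)
  have "v \<notin> set C'"
  proof
    assume "v \<in> set C'"
    then obtain x where "x \<in> set C" "step G x v"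
      using mv(1) by (metis in_set_conv_nth list_all2_conv_all_nth)
    then show False using assms(1) c by (auto simp: safe_def)
  qed
  then show ?thesis using mv(2) assms(1) c by (auto simp: captures_def safe_def)
qed

text \<open>Finiteness of the trap set is part of the invariant because \<^const>\<open>card\<close> is 0 on
  infinite sets.\<close>

lemma cops_play_invariant:
  assumes "cops_play m n G c" "c k = (C, T)"
  shows "length C = m \<and> set C \<subseteq> pverts G \<and> T \<subseteq> pverts G \<and> finite T \<and> card T \<le> n"
  using assms(2)
proof (induction k arbitrary: C T)
  case 0
  then show ?case
    using assms(1) by (auto simp: cops_play_def cops_start_def intro: finite_subset)
next
  case (Suc k)
  obtain C0 T0 where ck: "c k = (C0, T0)" by (cases "c k")
  have mv: "list_all2 (step G) C0 C" "T - T0 \<subseteq> set C" "card T \<le> n"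
    using assms(1) Suc.prems ck by (auto simp: cops_play_def cops_move_def dest!: spec[of _ k])
  have "set C \<subseteq> pverts G"
    using mv(1) by (auto simp: list_all2_conv_all_nth in_set_conv_nth step_def)
  moreover have "T \<subseteq> T0 \<union> set C" using mv(2) by blast
  moreover have "finite (T0 \<union> set C)" using Suc.IH[OF ck] by simp
  ultimately show ?case
    using Suc.IH[OF ck] mv list_all2_lengthD[OF mv(1)] by (auto intro: finite_subset)
qed

text \<open>Evasiveness is applied to the set of all cops and traps, which has at most
  \<open>m + n\<close> elements.\<close>

lemma evasive_safe_step:
  assumes ev: "evasive (m + n) G" and "length C = m" "set C \<subseteq> pverts G" "T \<subseteq> pverts G" "finite T"
    and "card T \<le> n" and "u \<in> pverts G" "\<not> captures (C, T) u"
  shows "\<exists>z. step G u z \<and> safe G (C, T) z"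
proof -
  have "card (set C \<union> T) \<le> m + n"
    using card_Un_le[of "set C" T] card_length[of C] assms(2,6) by linarith
  then obtain z where "z \<in> pverts G - (set C \<union> T)" "(u, z) \<in> parcs G"
    "\<forall>b\<in>set C \<union> T. (b, z) \<notin> parcs G"
    using ev[unfolded evasive_def, rule_format, of "set C \<union> T" u] assms(3-)
    by (auto simp: captures_def)
  then show ?thesis by (auto simp: step_def safe_def)
qed

lemma evasive_robber_wins:
  assumes ev: "evasive (m + n) G" and "finite (pverts G)" and big: "m + n < card (pverts G)"
  shows "robber_wins m n G"
proof -
  \<comment> \<open>The choice depends only on the current configuration and the robber's last
    vertex; \<open>rs = []\<close> marks the free initial placement.\<close>
  define \<sigma> :: "'a robber_strategy" where
    "\<sigma> = (\<lambda>cs rs. SOME z. safe G (last cs) z \<and> (rs = [] \<or> step G (last rs) z))"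
  have "robber_play G r \<and> \<not> caught c r"
    if play: "cops_play m n G c" and fol: "follows \<sigma> c r" for c r
  proof -
    have move: "cops_move n G (c k) (c (Suc k))" for k
      using play by (simp add: cops_play_def)
    have next_step: "\<exists>z. step G u z \<and> safe G (c k) z"
      if "u \<in> pverts G" "\<not> captures (c k) u" for k u
    proof -
      obtain C T where ck: "c k = (C, T)" by (cases "c k")
      show ?thesis
        using evasive_safe_step[OF ev, of C T u] cops_play_invariant[OF play ck] that ck by auto
    qed
    have r: "r k = (SOME z. safe G (c k) z \<and> (k = 0 \<or> step G (r (k - 1)) z))" for k
      using fol by (cases k) (auto simp: follows_def \<sigma>_def)
    have "safe G (c k) (r k) \<and> (k = 0 \<or> step G (r (k - 1)) (r k))" for k
    proof (induction k)
      case 0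
      obtain C T where c0: "c 0 = (C, T)" by (cases "c 0")
      \<comment> \<open>By \<open>big\<close> some vertex \<open>u\<close> is free of cops and
        traps; a virtual move from \<open>u\<close> shows that a safe starting vertex
        exists.\<close>
      have "card (set C \<union> T) \<le> m + n"
        using card_Un_le[of "set C" T] card_length[of C] cops_play_invariant[OF play c0]
        by linarith
      then have "\<not> pverts G \<subseteq> set C \<union> T"
        using big card_mono[of "set C \<union> T" "pverts G"] cops_play_invariant[OF play c0] by auto
      then obtain u where "u \<in> pverts G" "\<not> captures (c 0) u"
        by (auto simp: c0 captures_def)
      then have "\<exists>z. safe G (c 0) z" using next_step by blast
      then show ?case by (subst (1) r) (simp add: someI_ex)
    next
      case (Suc k)
      then have "r k \<in> pverts G" by (auto simp: safe_def split: prod.splits)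
      \<comment> \<open>Safety against \<open>c k\<close> yields non-capture by
        \<open>c (Suc k)\<close>, which is what \<open>next_step\<close> needs for the robber's next
        move.\<close>
      moreover have "\<not> captures (c (Suc k)) (r k)"
        using Suc safe_not_captures_move[OF _ move] by metis
      ultimately have "\<exists>z. safe G (c (Suc k)) z \<and> step G (r k) z"
        using next_step by blast
      from someI_ex[OF this] show ?case using r[of "Suc k"] by simp
    qed
    then have safe: "safe G (c k) (r k)" and st: "step G (r k) (r (Suc k))" for k
      by (blast, metis diff_Suc_1 nat.simps(3))
    have "r 0 \<in> pverts G" using safe[of 0] by (auto simp: safe_def split: prod.splits)
    with st have "robber_play G r" by (simp add: robber_play_def)
    moreover have "\<not> caught c r"
      unfolding caught_def
      using safe_not_captures[OF safe] safe_not_captures_move[OF safe move] by simp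
    ultimately show ?thesis ..
  qed
  then show ?thesis
    by (auto simp: robber_wins_def winning_robber_strategy_def)
qed

section \<open>Probability that a random graph fails to be evasive\<close>

definition separates :: "(nat set \<Rightarrow> bool) \<Rightarrow> nat \<Rightarrow> nat set \<Rightarrow> nat \<Rightarrow> bool" where
  "separates \<omega> u B z \<longleftrightarrow> \<omega> {u, z} \<and> (\<forall>b\<in>B. \<not> \<omega> {b, z})"

lemma finite_vertex_pairs: "finite (vertex_pairs N)"
  by (rule finite_subset[of _ "Pow {..<N}"]) (auto simp: vertex_pairs_def)

lemma vertex_pairs_doubleton: "{x, y} \<in> vertex_pairs N \<longleftrightarrow> x < N \<and> y < N \<and> x \<noteq> y"
  by (auto simp: vertex_pairs_def card_insert_if)

text \<open>Whether \<open>z\<close> separates depends only on the \<open>k + 1\<close> pairs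
  joining \<open>z\<close> to \<open>insert u B\<close>. For distinct \<open>z\<close> outside
  \<open>insert u B\<close> these blocks of pairs are disjoint, so the failures are independent,
  each with probability \<open>1 - p * (1 - p) ^ k\<close>.\<close>

lemma prob_no_separating_vertex:
  fixes p :: real
  assumes p: "0 < p" "p < 1" and B: "B \<subseteq> {..<N}" "card B = k" and u: "u < N" "u \<notin> B"
    and N: "k + 1 < N"
  shows "measure_pmf.prob (Pi_pmf (vertex_pairs N) False (\<lambda>_. bernoulli_pmf p))
           {\<omega>. \<forall>z\<in>{..<N} - insert u B. \<not> separates \<omega> u B z}
         = (1 - p * (1 - p) ^ k) ^ (N - (k + 1))"
proof -
  define M where "M = Pi_pmf (vertex_pairs N) False (\<lambda>_. bernoulli_pmf p)"
  define Z where "Z = {..<N} - insert u B"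
  define E where "E z = (\<lambda>x. {x, z}) ` insert u B" for z
  \<comment> \<open>The set \<open>{e = {u, z}}\<close> holds a single truth value: true at the pair
    \<open>{u, z}\<close>, false at all other pairs of the block.\<close>
  define S where "S z = (\<Pi>\<^sub>E e\<in>E z. {e = {u, z}})" for z
  define M' where "M' = (\<lambda>_ :: nat set. count_space (UNIV :: bool set))"
  have finB: "finite B" using B(1) finite_subset by blast
  have finE: "finite (E z)" for z using finB by (simp add: E_def)
  have cardZ: "card Z = N - (k + 1)"
    using B u finB by (simp add: Z_def card_Diff_subset)
  then have "Z \<noteq> {}" using N by (intro notI) simp
  moreover have "finite Z" by (simp add: Z_def)
  ultimately have Z: "Z \<noteq> {}" "finite Z" .
  have Esub: "E z \<subseteq> vertex_pairs N" if "z \<in> Z" for z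
    using that B u by (auto simp: E_def Z_def vertex_pairs_doubleton)
  \<comment> \<open>A pair common to the blocks of distinct \<open>z\<close> and \<open>z'\<close>
    would be \<open>{z, z'}\<close>, forcing \<open>z'\<close> into \<open>insert u B\<close>, which
    \<open>Z\<close> excludes.\<close>
  have disj: "disjoint_family_on E Z"
    by (auto simp: disjoint_family_on_def E_def Z_def doubleton_eq_iff)
  have inj: "inj_on (\<lambda>x. {x, z}) (insert u B)" for z
    by (auto simp: inj_on_def doubleton_eq_iff)
  have ind: "prob_space.indep_vars (measure_pmf M) M' (\<lambda>e \<omega>. \<omega> e) (vertex_pairs N)"
    unfolding M_def M'_def
    by (intro indep_vars_Pi_pmf finite_vertex_pairs)
  have single: "measure_pmf.prob M ((\<lambda>\<omega>. \<omega> e) -` {b} \<inter> space M) = (if b then p else 1 - p)"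
    if "e \<in> vertex_pairs N" for e b
  proof -
    have "measure_pmf.prob M ((\<lambda>\<omega>. \<omega> e) -` {b}) = measure_pmf.prob (map_pmf (\<lambda>\<omega>. \<omega> e) M) {b}"
      by simp
    also have "map_pmf (\<lambda>\<omega>. \<omega> e) M = bernoulli_pmf p"
      using that finite_vertex_pairs by (simp add: M_def Pi_pmf_component)
    also have "measure_pmf.prob (bernoulli_pmf p) {b} = (if b then p else 1 - p)"
      using p by (cases b) (simp_all add: measure_pmf_single)
    finally show ?thesis by simp
  qed
  have Smeas: "S z \<in> sets (PiM (E z) M')" for z
    unfolding S_def M'_def by (intro sets_PiM_I_finite finE) auto
  have Siff: "restrict \<omega> (E z) \<in> S z \<longleftrightarrow> separates \<omega> u B z" if "z \<in> Z" for z \<omega>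
    using that u(2) by (auto simp: S_def E_def separates_def PiE_iff Z_def doubleton_eq_iff)
  \<comment> \<open>Inside one block the coordinates are independent: the pair \<open>{u, z}\<close>
    contributes \<open>p\<close>, each of the \<open>k\<close> pairs \<open>{b, z}\<close>
    contributes \<open>1 - p\<close>.\<close>
  have sep: "measure_pmf.prob M {\<omega>. separates \<omega> u B z} = p * (1 - p) ^ k" if z: "z \<in> Z" for z
  proof -
    have "{\<omega>. separates \<omega> u B z} = (\<Inter>e\<in>E z. (\<lambda>\<omega>. \<omega> e) -` {e = {u, z}} \<inter> space M)"
      using u(2) by (auto simp: separates_def E_def doubleton_eq_iff)
    also have "measure_pmf.prob M \<dots> =
        (\<Prod>e\<in>E z. measure_pmf.prob M ((\<lambda>\<omega>. \<omega> e) -` {e = {u, z}} \<inter> space M))"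
      using Esub[OF z] finE
      by (intro prob_space.indep_varsD[OF measure_pmf.prob_space_axioms ind])
        (auto simp: E_def M'_def)
    also have "\<dots> = (\<Prod>e\<in>E z. if e = {u, z} then p else 1 - p)"
      using Esub[OF z] by (intro prod.cong refl single) blast
    also have "\<dots> = (\<Prod>x\<in>insert u B. if x = u then p else 1 - p)"
      unfolding E_def by (subst prod.reindex[OF inj]) (auto simp: doubleton_eq_iff intro!: prod.cong)
    also have "\<dots> = p * (\<Prod>x\<in>B. if x = u then p else 1 - p)"
      using u(2) finB by simp
    also have "(\<Prod>x\<in>B. if x = u then p else 1 - p) = (\<Prod>x\<in>B. 1 - p)"
      using u(2) by (intro prod.cong) auto
    finally show ?thesis by (simp add: B(2))
  qed
  \<comment> \<open>Independence passes from single pairs to the restrictions to disjoint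
    blocks.\<close>
  have ind': "prob_space.indep_vars (measure_pmf M) (\<lambda>z. PiM (E z) M') (\<lambda>z \<omega>. restrict \<omega> (E z)) Z"
    using prob_space.indep_vars_restrict[OF measure_pmf.prob_space_axioms ind Esub disj] by simp
  have compl: "space (PiM (E z) M') - S z \<in> sets (PiM (E z) M')" for z
    using Smeas by blast
  have preim: "(\<lambda>\<omega>. restrict \<omega> (E z)) -` (space (PiM (E z) M') - S z) \<inter> space M =
      {\<omega>. \<not> separates \<omega> u B z}" if "z \<in> Z" for z
    using Siff[OF that] by (auto simp: space_PiM M'_def)
  have "{\<omega>. \<forall>z\<in>Z. \<not> separates \<omega> u B z} =
      (\<Inter>z\<in>Z. (\<lambda>\<omega>. restrict \<omega> (E z)) -` (space (PiM (E z) M') - S z) \<inter> space M)"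
    using preim by auto
  also have "measure_pmf.prob M \<dots> = (\<Prod>z\<in>Z. measure_pmf.prob M
      ((\<lambda>\<omega>. restrict \<omega> (E z)) -` (space (PiM (E z) M') - S z) \<inter> space M))"
    using Z compl by (intro prob_space.indep_varsD[OF measure_pmf.prob_space_axioms ind']) auto
  also have "\<dots> = (\<Prod>z\<in>Z. 1 - p * (1 - p) ^ k)"
  proof (intro prod.cong refl)
    fix z assume z: "z \<in> Z"
    have "measure_pmf.prob M {\<omega>. \<not> separates \<omega> u B z}
        = 1 - measure_pmf.prob M {\<omega>. separates \<omega> u B z}"
      using measure_pmf.prob_compl[of "{\<omega>. separates \<omega> u B z}" M]
      by (simp add: Compl_eq_Diff_UNIV[symmetric] Collect_neg_eq)
    then show "measure_pmf.prob M
        ((\<lambda>\<omega>. restrict \<omega> (E z)) -` (space (PiM (E z) M') - S z) \<inter> space M) = 1 - p * (1 - p) ^ k"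
      using preim[OF z] sep[OF z] by simp
  qed
  finally show ?thesis using cardZ by (simp add: M_def Z_def)
qed

text \<open>A smaller set can be enlarged to exactly \<open>k\<close> vertices avoiding
  \<open>u\<close>, since \<open>k < N\<close> leaves enough room, and a vertex that separates
  \<open>u\<close> from the larger set also serves the smaller one.\<close>

lemma evasive_graph_ofI:
  assumes "k < N"
    and sep: "\<And>B u. B \<subseteq> {..<N} \<Longrightarrow> card B = k \<Longrightarrow> u < N \<Longrightarrow> u \<notin> B \<Longrightarrow>
      \<exists>z\<in>{..<N} - insert u B. separates \<omega> u B z"
  shows "evasive k (graph_of N \<omega>)"
  unfolding evasive_def
proof (intro allI impI)
  fix A u
  assume A: "A \<subseteq> pverts (graph_of N \<omega>) \<and> card A \<le> k \<and> u \<in> pverts (graph_of N \<omega>) - A"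
  then have "A \<subseteq> {..<N} - {u}" "u < N" by (auto simp: graph_of_def)
  moreover from this assms(1) have "k \<le> card ({..<N} - {u})" by simp
  ultimately obtain B where B: "A \<subseteq> B" "B \<subseteq> {..<N} - {u}" "card B = k"
    using exists_subset_between[of A k "{..<N} - {u}"] A by auto
  then obtain z where "z \<in> {..<N} - insert u B" "separates \<omega> u B z"
    using sep[of B u] \<open>u < N\<close> by auto
  then show "\<exists>z\<in>pverts (graph_of N \<omega>) - A. (u, z) \<in> parcs (graph_of N \<omega>) \<and>
      (\<forall>b\<in>A. (b, z) \<notin> parcs (graph_of N \<omega>))"
    using B \<open>u < N\<close>
    by (intro bexI[of _ z]) (auto simp: graph_of_def separates_def vertex_pairs_doubleton)
qed

text \<open>Union bound over the pairs \<open>(B, u)\<close>: if the robber does not win, the graph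
  is not evasive, so some pair has no separating vertex.\<close>

lemma prob_not_robber_wins_le:
  fixes p :: real
  assumes p: "0 < p" "p < 1" and k: "k = m + n" and N: "k + 1 < N"
  shows "measure_pmf.prob (random_graph N p) {G. \<not> robber_wins m n G}
         \<le> real N ^ (k + 1) * (1 - p * (1 - p) ^ k) ^ (N - (k + 1))"
proof -
  define M where "M = Pi_pmf (vertex_pairs N) False (\<lambda>_. bernoulli_pmf p)"
  define I where "I = {B. B \<subseteq> {..<N} \<and> card B = k} \<times> {..<N}"
  define J where "J = {(B, u) \<in> I. u \<notin> B}"
  define F where "F = (\<lambda>(B, u). {\<omega>. \<forall>z\<in>{..<N} - insert u B. \<not> separates \<omega> u B z})"
  define q where "q = (1 - p * (1 - p) ^ k) ^ (N - (k + 1))"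
  have finI: "finite I" by (simp add: I_def)
  then have finJ: "finite J" by (rule finite_subset[rotated]) (auto simp: J_def)
  \<comment> \<open>For counting, the condition \<open>u \<notin> B\<close> is dropped: there are at
    most \<open>N ^ k\<close> sets \<open>B\<close> and \<open>N\<close> vertices
    \<open>u\<close>.\<close>
  have "card J \<le> card I" using finI by (intro card_mono) (auto simp: J_def)
  also have "card I = (N choose k) * N" by (simp add: I_def card_cartesian_product n_subsets)
  also have "\<dots> \<le> N ^ k * N" using binomial_le_pow[of k N] N by simp
  finally have "real (card J) \<le> real (N ^ (k + 1))" by (subst of_nat_le_iff) (simp add: mult.commute)
  then have cardJ: "real (card J) \<le> real N ^ (k + 1)" by simp
  have q0: "0 \<le> q" using p by (auto simp: q_def intro!: zero_le_power mult_le_one power_le_one)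
  have "{\<omega>. \<not> robber_wins m n (graph_of N \<omega>)} \<subseteq> (\<Union>j\<in>J. F j)"
  proof
    fix \<omega> assume "\<omega> \<in> {\<omega>. \<not> robber_wins m n (graph_of N \<omega>)}"
    then have "\<not> evasive k (graph_of N \<omega>)"
      using evasive_robber_wins[of m n "graph_of N \<omega>"] N by (auto simp: k graph_of_def)
    then show "\<omega> \<in> (\<Union>j\<in>J. F j)"
      using evasive_graph_ofI[of k N \<omega>] N by (fastforce simp: J_def I_def F_def)
  qed
  then have "measure_pmf.prob M {\<omega>. \<not> robber_wins m n (graph_of N \<omega>)}
      \<le> measure_pmf.prob M (\<Union>j\<in>J. F j)"
    by (intro measure_pmf.finite_measure_mono) auto
  also have "\<dots> \<le> (\<Sum>j\<in>J. measure_pmf.prob M (F j))"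
    using finJ by (intro measure_pmf.finite_measure_subadditive_finite) auto
  also have "\<dots> = (\<Sum>j\<in>J. q)"
    using prob_no_separating_vertex[OF p] N
    by (intro sum.cong) (auto simp: J_def I_def F_def M_def q_def)
  also have "\<dots> \<le> real N ^ (k + 1) * q"
    using cardJ q0 by (simp add: mult_right_mono)
  finally show ?thesis
    by (simp add: random_graph_def M_def q_def vimage_def)
qed

section \<open>Passage to the limit\<close>

lemma power_times_geometric_tendsto_0:
  fixes c :: real
  assumes "0 < c" "c < 1"
  shows "(\<lambda>N. real N ^ a * c ^ (N - b)) \<longlonglongrightarrow> 0"
proof -
  have "(\<lambda>N. real N ^ a * c ^ N / c ^ b) \<longlonglongrightarrow> 0"
    using assms by real_asymp
  \<comment> \<open>The shift by \<open>b\<close> costs the constant factor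
    \<open>1 / c ^ b\<close>, but only from \<open>N = b\<close> on, as \<open>N - b\<close> is
    truncated below that.\<close>
  moreover have "\<forall>\<^sub>F N in sequentially. real N ^ a * c ^ N / c ^ b = real N ^ a * c ^ (N - b)"
    using eventually_ge_at_top[of b]
    by (rule eventually_mono) (use assms in \<open>simp add: power_diff\<close>)
  ultimately show ?thesis by (rule Lim_transform_eventually)
qed

theorem theorem4:
  fixes p :: real and m n :: nat
  assumes "0 < p" and "p < 1" and "m \<ge> 1" and "n \<ge> 1"
  shows "(\<lambda>N. measure_pmf.prob (random_graph N p) {G. robber_wins m n G}) \<longlonglongrightarrow> 1"
proof -
  define k where "k = m + n"
  define b where "b N = real N ^ (k + 1) * (1 - p * (1 - p) ^ k) ^ (N - (k + 1))" for N
  \<comment> \<open>This keeps the base \<open>1 - p * (1 - p) ^ k\<close> positive; it is below 1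
    because \<open>0 < p < 1\<close>.\<close>
  have "p * (1 - p) ^ k \<le> p"
    using assms by (intro mult_left_le power_le_one) auto
  then have "p * (1 - p) ^ k < 1" using assms by linarith
  then have "b \<longlonglongrightarrow> 0"
    unfolding b_def using assms by (intro power_times_geometric_tendsto_0) auto
  then have "(\<lambda>N. 1 - b N) \<longlonglongrightarrow> 1" using tendsto_diff[OF tendsto_const] by fastforce
  moreover have "\<forall>\<^sub>F N in sequentially.
      1 - b N \<le> measure_pmf.prob (random_graph N p) {G. robber_wins m n G}"
    using eventually_gt_at_top[of "k + 1"]
  proof eventually_elim
    case (elim N)
    have "measure_pmf.prob (random_graph N p) {G. \<not> robber_wins m n G}
        = 1 - measure_pmf.prob (random_graph N p) {G. robber_wins m n G}"
      using measure_pmf.prob_compl[of "{G. robber_wins m n G}" "random_graph N p"]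
      by (simp add: Compl_eq_Diff_UNIV[symmetric] Collect_neg_eq)
    then show ?case
      using prob_not_robber_wins_le[OF assms(1,2) k_def elim] by (simp add: b_def)
  qed
  \<comment> \<open>The probability is squeezed between \<open>1 - b N\<close> and the constant
    1.\<close>
  ultimately show ?thesis
    by (rule tendsto_sandwich[OF _ _ _ tendsto_const, rotated 2]) (auto intro: always_eventually)
qed

end
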